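(* Let $n,k\ge 1$. If $w\in\mathcal{L}^k_n$, then a necessary condition for $w$ is that $\mathrm{Schur}(\widehat{W})=0$, i.e. $$\begin{bmatrix}w^{(n+nk)}&\cdots&w^{(n+nk+k-1)}\end{bmatrix}-\begin{bmatrix}w^{(n)}&\cdots&w^{(n-1+nk)}\end{bmatrix}\widehat{W}^{-1}\widetilde{W}=0,$$ where $$\widehat{W}=\begin{bmatrix} w&\cdots&w^{(nk-1)}\\ \vdots&&\vdots\\ w^{(n-1)}&\cdots&w^{(n-1+nk-1)}\end{bmatrix},\qquad \widetilde{W}=\begin{bmatrix} w^{(nk)}&\cdots&w^{(nk+k-1)}\\ \vdots&&\vdots\\ w^{(n-1+nk)}&\cdots&w^{(n+nk+k-2)}\end{bmatrix}.$$ Moreover, letting $\mathbf{Op}\,w$ denote the left-hand side of the displayed equation (a nonlinear operator in $w$), the functions $w$ satisfying $\mathbf{Op}\,w=0$ form the $n$th order LTID type in $k$ variables, $\mathcal{L}^k_n$.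
   Context: $\mathcal{L}^k_n$ is the linear time invariant differential (LTID) type of order $n$ in $k$ variables, i.e. the set of all solutions to any system of $k$ constant-coefficient homogeneous differential equations of $n$th order: the set of $w\in C^n(\mathbb{R},\mathbb{R}^k)$ for which there exists a polynomial matrix $R(\xi)=R_0\xi^n+R_1\xi^{n-1}+\cdots+R_n\in\mathbb{R}[\xi]^{k\times k}$ (depending on $w$) with $R(\mathbf{D})w=0$, where $\mathbf{D}$ is differentiation. It is assumed that $R_0=I$ and that the system of differential equations is not underdetermined or overdetermined, so that $w\in\mathcal{L}^k_n$ means $w^{(n)}+R_1w^{(n-1)}+\cdots+R_nw=0$ for some constant matrices $R_1,\dots,R_n\in\mathbb{R}^{k\times k}$. Here $w^{(j)}$ is the $j$-th derivative of $w$, a column vector of length $k$, so $\widehat{W}$ is $nk\times nk$ and $\widetilde{W}$ is $nk\times k$. $\mathrm{Schur}(\widehat{W})$ denotes the Schur complement of the upper left block $\widehat{W}$ in the generalized Wronskian $$\begin{bmatrix} w&\dot w&\cdots&w^{(nk+k-1)}\\ \vdots&\vdots&&\vdots\\ w^{(n)}&w^{(n+1)}&\cdots&w^{(n+nk+k-1)}\end{bmatrix},$$ whose upper right block is $\widetilde{W}$ and whose last block row is $\begin{bmatrix}w^{(n)}&\cdots&w^{(n-1+nk)}\,|\,w^{(n+nk)}&\cdots&w^{(n+nk+k-1)}\end{bmatrix}$.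
   Formalization: Schur(Ŵ)=0 is asserted only at points t where Ŵ is invertible, and the functions with Op w=0 are shown to be exactly those w in L^k_n whose Ŵ is invertible at some t; otherwise (e.g. w=0, which lies in L^k_n) Ŵ^{-1} does not exist and Op w is undefined. *)

theory Defs
  imports
    "HOL-Analysis.Derivative"
    "Jordan_Normal_Form.Gauss_Jordan_Elimination"
begin

unbundle no vec_syntax

text \<open>A function from \<open>\<real>\<close> to \<open>\<real>^k\<close> is a function \<open>w :: real \<Rightarrow> real vec\<close> all of whose
  values lie in \<open>carrier_vec k\<close>.  The type \<open>real vec\<close> carries no topology, so differentiation
  is done component by component.\<close>

definition nth_deriv :: "nat \<Rightarrow> nat \<Rightarrow> (real \<Rightarrow> real vec) \<Rightarrow> real \<Rightarrow> real vec" where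
  "nth_deriv k m w t = vec k (\<lambda>i. (deriv ^^ m) (\<lambda>s. w s $ i) t)"

definition C_space :: "nat \<Rightarrow> nat \<Rightarrow> (real \<Rightarrow> real vec) set" where
  "C_space m k = {w. (\<forall>t. w t \<in> carrier_vec k) \<and>
     (\<forall>i<k. (\<forall>l<m. \<forall>t. (deriv ^^ l) (\<lambda>s. w s $ i) differentiable (at t)) \<and>
            continuous_on UNIV ((deriv ^^ m) (\<lambda>s. w s $ i)))}"

text \<open>\<open>poly_diff_op n k R w\<close> is \<open>R(D) w\<close> for the polynomial matrix
  \<open>R(\<xi>) = R 0 \<xi>^n + R 1 \<xi>^(n-1) + \<dots> + R n\<close>.\<close>

definition poly_diff_op ::
    "nat \<Rightarrow> nat \<Rightarrow> (nat \<Rightarrow> real mat) \<Rightarrow> (real \<Rightarrow> real vec) \<Rightarrow> real \<Rightarrow> real vec" where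
  "poly_diff_op n k R w t =
     finsum_vec TYPE(real) k (\<lambda>j. R j *\<^sub>v nth_deriv k (n - j) w t) {0..n}"

definition LTID :: "nat \<Rightarrow> nat \<Rightarrow> (real \<Rightarrow> real vec) set" where
  "LTID n k = {w \<in> C_space n k. \<exists>R. (\<forall>j\<in>{0..n}. R j \<in> carrier_mat k k) \<and> R 0 = 1\<^sub>m k \<and>
     (\<forall>t. poly_diff_op n k R w t = 0\<^sub>v k)}"

text \<open>\<open>wronski_block k p q m w t\<close> has \<open>p\<close> block rows, each consisting of \<open>k\<close> rows, and \<open>q\<close>
  columns.  The column vector in block row \<open>i\<close> and column \<open>j\<close> is the derivative of \<open>w\<close> of
  order \<open>m + i + j\<close> at \<open>t\<close>.\<close>

definition wronski_block ::
    "nat \<Rightarrow> nat \<Rightarrow> nat \<Rightarrow> nat \<Rightarrow> (real \<Rightarrow> real vec) \<Rightarrow> real \<Rightarrow> real mat" where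
  "wronski_block k p q m w t =
     mat (p * k) q (\<lambda>(i, j). nth_deriv k (m + i div k + j) w t $ (i mod k))"

definition gen_wronskian :: "nat \<Rightarrow> nat \<Rightarrow> (real \<Rightarrow> real vec) \<Rightarrow> real \<Rightarrow> real mat" where
  "gen_wronskian n k w t = wronski_block k (n + 1) (n * k + k) 0 w t"

definition W_hat :: "nat \<Rightarrow> nat \<Rightarrow> (real \<Rightarrow> real vec) \<Rightarrow> real \<Rightarrow> real mat" where
  "W_hat n k w t = wronski_block k n (n * k) 0 w t"

definition W_tilde :: "nat \<Rightarrow> nat \<Rightarrow> (real \<Rightarrow> real vec) \<Rightarrow> real \<Rightarrow> real mat" where
  "W_tilde n k w t = wronski_block k n k (n * k) w t"

definition W_last_left :: "nat \<Rightarrow> nat \<Rightarrow> (real \<Rightarrow> real vec) \<Rightarrow> real \<Rightarrow> real mat" where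
  "W_last_left n k w t = wronski_block k 1 (n * k) n w t"

definition W_last_right :: "nat \<Rightarrow> nat \<Rightarrow> (real \<Rightarrow> real vec) \<Rightarrow> real \<Rightarrow> real mat" where
  "W_last_right n k w t = wronski_block k 1 k (n + n * k) w t"

lemma gen_wronskian_blocks:
  "gen_wronskian n k w t =
     four_block_mat (W_hat n k w t) (W_tilde n k w t) (W_last_left n k w t) (W_last_right n k w t)"
  (is "?L = ?M")
proof (rule eq_matI)
  show "dim_row ?L = dim_row ?M" "dim_col ?L = dim_col ?M"
    by (simp_all add: gen_wronskian_def W_hat_def W_last_right_def wronski_block_def)
next
  fix i j
  assume "i < dim_row ?M" and "j < dim_col ?M"
  then have i: "i < n * k + k" and j: "j < n * k + k"
    by (simp_all add: W_hat_def W_last_right_def wronski_block_def)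
  have lo: "(i - n * k) div k = 0" "(i - n * k) mod k = i mod k" "i div k = n"
    if "\<not> i < n * k"
  proof -
    have r: "i - n * k < k" using that i by linarith
    have i_eq: "i = (i - n * k) + n * k" using that by linarith
    show "(i - n * k) div k = 0" using r by (rule div_less)
    show "(i - n * k) mod k = i mod k" by (metis i_eq mod_mult_self3 add.commute)
    show "i div k = n" using that i by (intro div_nat_eqI) (simp_all add: mult.commute)
  qed
  define N where "N = n * k"
  have nk: "(n + 1) * k = N + k" by (simp add: N_def)
  note defs = gen_wronskian_def W_hat_def W_tilde_def W_last_left_def W_last_right_def
    wronski_block_def N_def[symmetric] nk
  show "?L $$ (i, j) = ?M $$ (i, j)"
  proof (cases "i < N")
    case True
    then show ?thesis using i j unfolding defs by (cases "j < N") simp_all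
  next
    case False
    define q where "q = i div k"
    have q: "q = n" and lo': "(i - N) div k = 0" "(i - N) mod k = i mod k"
      using lo[OF False[unfolded N_def]] unfolding q_def N_def by blast+
    show ?thesis
      using i j False unfolding defs
      by (cases "j < N") (simp_all add: lo' q_def[symmetric] q)
  qed
qed

text \<open>The Schur complement of \<open>A\<close> in \<open>four_block_mat A B C D\<close>; it is meaningful only if \<open>A\<close>
  is invertible.\<close>

definition schur_complement ::
    "real mat \<Rightarrow> real mat \<Rightarrow> real mat \<Rightarrow> real mat \<Rightarrow> real mat" where
  "schur_complement A B C D = D - C * the (mat_inverse A) * B"

definition Op :: "nat \<Rightarrow> nat \<Rightarrow> (real \<Rightarrow> real vec) \<Rightarrow> real \<Rightarrow> real mat" where
  "Op n k w t =
     schur_complement (W_hat n k w t) (W_tilde n k w t) (W_last_left n k w t) (W_last_right n k w t)"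

text \<open>The inverse of \<open>W_hat\<close> does not exist at every \<open>t\<close> for every \<open>w\<close>, so \<open>Op w\<close> is
  a partially defined function of \<open>t\<close>, with the following domain.\<close>

definition Op_dom :: "nat \<Rightarrow> nat \<Rightarrow> (real \<Rightarrow> real vec) \<Rightarrow> real set" where
  "Op_dom n k w = {t. invertible_mat (W_hat n k w t)}"

end

theory Submission
  imports Defs "Jordan_Normal_Form.Determinant"
begin

text \<open>
  Let \<open>v_j\<close> be the column with blocks \<open>w^(j), \<dots>, w^(j+n-1)\<close>, so that \<open>v_j' = v_(j+1)\<close>. An equation
  \<open>w^(n) = Q v_0\<close> with constant \<open>Q\<close> can be differentiated to \<open>w^(n+j) = Q v_j\<close> for all \<open>j\<close>; hence
  the last block row of the generalized Wronskian is \<open>Q\<close> times the rows above it and the Schur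
  complement vanishes. Conversely, let \<open>Q(t)\<close> be the last block row of the left part times
  \<open>W_hat(t)^(-1)\<close>. Vanishing of the Schur complement extends \<open>w^(n+j) = Q v_j\<close> to \<open>j < nk + k\<close>, and
  comparing its derivative with the next relation gives \<open>Q' W_hat = 0\<close>, so \<open>Q\<close> is locally constant
  where \<open>W_hat\<close> is invertible. On an interval of such points \<open>W_hat\<close> is a fundamental matrix of a
  constant coefficient system, so it stays invertible at the end points; therefore it is invertible
  on the whole line as soon as it is invertible somewhere.
\<close>

section \<open>Matrices\<close>

lemma adj_mat_inverse:
  assumes A: "(A :: real mat) \<in> carrier_mat N N" and d: "det A \<noteq> 0"
  shows "A * ((1 / det A) \<cdot>\<^sub>m adj_mat A) = 1\<^sub>m N"
    and "((1 / det A) \<cdot>\<^sub>m adj_mat A) * A = 1\<^sub>m N"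
  using adj_mat[OF A] d A
  by (auto simp: mult_smult_distrib[OF A] mult_smult_assoc_mat[OF _ A])

lemma invertible_mat_iff_det:
  assumes A: "(A :: real mat) \<in> carrier_mat N N"
  shows "invertible_mat A \<longleftrightarrow> det A \<noteq> 0"
proof
  assume "invertible_mat A"
  then obtain B where AB: "A * B = 1\<^sub>m N" and BA: "B * A = 1\<^sub>m (dim_row B)"
    using A by (auto simp: invertible_mat_def inverts_mat_def)
  have "dim_col B = N" using arg_cong[OF AB, of dim_col] by simp
  moreover have "dim_row B = N" using arg_cong[OF BA, of dim_col] A by simp
  ultimately have "det A * det B = 1"
    using det_mult[OF A, of B] AB by (metis carrier_matI det_one)
  then show "det A \<noteq> 0" by auto
next
  assume d: "det A \<noteq> 0"
  let ?B = "(1 / det A) \<cdot>\<^sub>m adj_mat A"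
  have "A * ?B = 1\<^sub>m N" "?B * A = 1\<^sub>m N" by (fact adj_mat_inverse[OF A d])+
  moreover have "dim_row ?B = N" using adj_mat(1)[OF A] by auto
  ultimately show "invertible_mat A" using A
    unfolding invertible_mat_def inverts_mat_def by (auto intro!: exI[of _ ?B])
qed

text \<open>\<open>mat_inverse\<close> comes from Gauss-Jordan elimination, which hides how the
  result depends on the entries. Uniqueness of inverses identifies it with the scaled adjugate, a
  rational expression in the entries of \<open>A\<close>.\<close>

lemma the_mat_inverse:
  assumes A: "(A :: real mat) \<in> carrier_mat N N" and d: "det A \<noteq> 0"
  shows "the (mat_inverse A) \<in> carrier_mat N N"
    and "A * the (mat_inverse A) = 1\<^sub>m N"
    and "the (mat_inverse A) * A = 1\<^sub>m N"
    and "the (mat_inverse A) = (1 / det A) \<cdot>\<^sub>m adj_mat A"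
proof -
  let ?B = "(1 / det A) \<cdot>\<^sub>m adj_mat A"
  have B: "?B \<in> carrier_mat N N" using adj_mat(1)[OF A] by simp
  have inv: "A * ?B = 1\<^sub>m N" "?B * A = 1\<^sub>m N" by (fact adj_mat_inverse[OF A d])+
  have "A \<in> Units (ring_mat TYPE(real) N ())"
    using A B inv by (auto simp: Units_def ring_mat_simps)
  then obtain X where X: "mat_inverse A = Some X"
    using mat_inverse(1)[OF A, where b = "()"] by (cases "mat_inverse A") auto
  have XA: "A * X = 1\<^sub>m N" "X * A = 1\<^sub>m N" "X \<in> carrier_mat N N"
    using mat_inverse(2)[OF A X] by auto
  have "X = X * (A * ?B)" using XA inv by simp
  also have "\<dots> = (X * A) * ?B" by (rule assoc_mult_mat[OF XA(3) A B, symmetric])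
  also have "\<dots> = ?B" unfolding XA(2) by (rule left_mult_one_mat[OF B])
  finally have "X = ?B" .
  with X XA show "the (mat_inverse A) \<in> carrier_mat N N"
    "A * the (mat_inverse A) = 1\<^sub>m N" "the (mat_inverse A) * A = 1\<^sub>m N"
    "the (mat_inverse A) = ?B" by auto
qed

text \<open>The transpose of \<open>A\<close> has the same determinant and annihilates the column
  vector \<open>c\<close>. This turns \<open>Q' W_hat = 0\<close> into
  \<open>Q' = 0\<close>.\<close>

lemma left_kernel_trivial:
  assumes A: "(A :: real mat) \<in> carrier_mat N N" and d: "det A \<noteq> 0"
    and z: "\<And>j. j < N \<Longrightarrow> (\<Sum>l<N. c l * A $$ (l, j)) = 0" and l: "l < N"
  shows "c l = 0"
proof -
  have "transpose_mat A *\<^sub>v vec N c = 0\<^sub>v N"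
    using A z by (intro eq_vecI) (auto simp: scalar_prod_def lessThan_atLeast0 mult.commute)
  moreover have "det (transpose_mat A) \<noteq> 0" using d det_transpose[OF A] by simp
  moreover have "transpose_mat A \<in> carrier_mat N N" using A by simp
  ultimately have "vec N c = 0\<^sub>v N"
    using det_0_iff_vec_prod_zero[of "transpose_mat A" N] vec_carrier[of N c] by blast
  then have "vec N c $ l = 0" using l by simp
  then show ?thesis using l by simp
qed

section \<open>Differentiability of determinants and cofactors\<close>

lemma differentiable_prod:
  fixes f :: "'i \<Rightarrow> real \<Rightarrow> real"
  assumes "finite I" "\<And>i. i \<in> I \<Longrightarrow> f i differentiable (at t)"
  shows "(\<lambda>s. \<Prod>i\<in>I. f i s) differentiable (at t)"
  using assms by (induction I rule: finite_induct) (auto intro!: differentiable_mult)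

lemma det_differentiable:
  fixes A :: "real \<Rightarrow> real mat"
  assumes A: "\<And>s. A s \<in> carrier_mat N N"
    and d: "\<And>i j. i < N \<Longrightarrow> j < N \<Longrightarrow> (\<lambda>s. A s $$ (i, j)) differentiable (at t)"
  shows "(\<lambda>s. det (A s)) differentiable (at t)"
proof -
  have "(\<lambda>s. \<Prod>i = 0..<N. A s $$ (i, p i)) differentiable (at t)" if "p permutes {0..<N}" for p
    using permutes_in_image[OF that] by (intro differentiable_prod d) auto
  then show ?thesis
    unfolding det_def'[OF A]
    by (intro differentiable_sum differentiable_mult differentiable_const
        finite_permutations) auto
qed

lemma cofactor_differentiable:
  fixes A :: "real \<Rightarrow> real mat"
  assumes A: "\<And>s. A s \<in> carrier_mat N N"
    and d: "\<And>i j. i < N \<Longrightarrow> j < N \<Longrightarrow> (\<lambda>s. A s $$ (i, j)) differentiable (at t)"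
  shows "(\<lambda>s. cofactor (A s) i j) differentiable (at t)"
proof -
  have "(\<lambda>s. mat_delete (A s) i j $$ (i', j')) differentiable (at t)"
    if "i' < N - 1" "j' < N - 1" for i' j'
    using that carrier_matD[OF A] unfolding mat_delete_def by (auto intro!: d)
  then show ?thesis unfolding cofactor_def
    using mat_delete_carrier[OF A]
    by (intro differentiable_mult differentiable_const det_differentiable[where N = "N - 1"]) auto
qed

section \<open>Linear differential systems\<close>

text \<open>The bound makes \<open>E t * exp (K * t)\<close> nondecreasing and
  \<open>E t * exp (-K * t)\<close> nonincreasing on the interval; the first is compared with its
  value 0 at the right end, the second with its value 0 at the left end. The bound is asked for only
  inside the interval, and continuity carries the comparison to the end point.\<close>

lemma gronwall_zero:
  fixes E E' :: "real \<Rightarrow> real"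
  assumes der: "\<And>t. (E has_real_derivative E' t) (at t)"
    and nonneg: "\<And>t. E t \<ge> 0"
    and bound: "\<And>t. t \<in> {a<..<b} \<Longrightarrow> \<bar>E' t\<bar> \<le> K * E t"
    and c: "c = a \<or> c = b" "E c = 0" and t: "t \<in> {a<..<b}"
  shows "E t = 0"
proof -
  have fd: "((\<lambda>t. E t * exp (s * t)) has_real_derivative (E' t + s * E t) * exp (s * t)) (at t)"
    for s t
    by (rule derivative_eq_intros der refl)+ (simp add: algebra_simps)
  have cont: "continuous_on S (\<lambda>t. E t * exp (s * t))" for S s
    using fd by (meson DERIV_isCont continuous_at_imp_continuous_on)
  have "E t \<le> 0"
    using c(1)
  proof
    assume "c = b"
    have "E t * exp (K * t) \<le> E b * exp (K * b)"
    proof (rule DERIV_nonneg_imp_increasing_open[OF _ _ cont])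
      show "t \<le> b" using t by simp
      fix x assume "t < x" "x < b"
      then have "\<bar>E' x\<bar> \<le> K * E x" using t by (intro bound) simp
      then have "0 \<le> (E' x + K * E x) * exp (K * x)" by simp
      then show "\<exists>y. ((\<lambda>t. E t * exp (K * t)) has_real_derivative y) (at x) \<and> 0 \<le> y"
        using fd[of K x] by blast
    qed
    then show ?thesis using c(2) \<open>c = b\<close> by (simp add: mult_le_0_iff)
  next
    assume "c = a"
    have "E t * exp (-K * t) \<le> E a * exp (-K * a)"
    proof (rule DERIV_nonpos_imp_decreasing_open[OF _ _ cont])
      show "a \<le> t" using t by simp
      fix x assume "a < x" "x < t"
      then have "\<bar>E' x\<bar> \<le> K * E x" using t by (intro bound) simp
      then have "(E' x + -K * E x) * exp (-K * x) \<le> 0" by (simp add: mult_le_0_iff)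
      then show "\<exists>y. ((\<lambda>t. E t * exp (-K * t)) has_real_derivative y) (at x) \<and> y \<le> 0"
        using fd[of "-K" x] by blast
    qed
    then show ?thesis using c(2) \<open>c = a\<close> by (simp add: mult_le_0_iff)
  qed
  with nonneg[of t] show ?thesis by simp
qed

text \<open>Energy argument: the sum of squares of a solution satisfies the hypotheses of
  \<open>gronwall_zero\<close>.\<close>

lemma linear_system_zero:
  fixes u u' :: "nat \<Rightarrow> real \<Rightarrow> real"
  assumes der: "\<And>i t. i < N \<Longrightarrow> (u i has_real_derivative u' i t) (at t)"
    and ode: "\<And>i t. i < N \<Longrightarrow> t \<in> {a<..<b} \<Longrightarrow> u' i t = (\<Sum>m<N. M i m * u m t)"
    and c: "c = a \<or> c = b" "\<And>i. i < N \<Longrightarrow> u i c = 0"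
    and t: "t \<in> {a<..<b}" and i: "i < N"
  shows "u i t = 0"
proof -
  define E where "E = (\<lambda>t. \<Sum>i<N. (u i t)\<^sup>2)"
  define E' where "E' = (\<lambda>t. \<Sum>i<N. 2 * u i t * u' i t)"
  \<comment> \<open>In \<open>E'\<close> each product \<open>u i t * u m t\<close> carries the
    factor \<open>2 * M i m\<close> and is at most \<open>E t\<close> in absolute value.\<close>
  define K where "K = (\<Sum>i<N. \<Sum>m<N. 2 * \<bar>M i m\<bar>)"
  have dE: "(E has_real_derivative E' t) (at t)" for t
    unfolding E_def E'_def
    by (rule DERIV_sum) (auto intro!: derivative_eq_intros der)
  have E_ge: "(u i t)\<^sup>2 \<le> E t" if "i < N" for i t
    unfolding E_def using that by (intro member_le_sum) auto
  have bound: "\<bar>E' t\<bar> \<le> K * E t" if "t \<in> {a<..<b}" for t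
  proof -
    have "E' t = (\<Sum>i<N. \<Sum>m<N. 2 * (M i m * (u i t * u m t)))"
      unfolding E'_def using ode that
      by (intro sum.cong) (auto simp: sum_distrib_left mult_ac)
    also have "\<bar>\<dots>\<bar> \<le> (\<Sum>i<N. \<Sum>m<N. \<bar>2 * (M i m * (u i t * u m t))\<bar>)"
      by (intro order_trans[OF sum_abs] sum_mono sum_abs)
    also have "\<dots> \<le> (\<Sum>i<N. \<Sum>m<N. 2 * \<bar>M i m\<bar> * E t)"
    proof (intro sum_mono)
      fix i m assume im: "i \<in> {..<N}" "m \<in> {..<N}"
      have "2 * \<bar>u i t * u m t\<bar> \<le> (u i t)\<^sup>2 + (u m t)\<^sup>2"
        using sum_squares_bound[of "\<bar>u i t\<bar>" "\<bar>u m t\<bar>"] by (simp add: abs_mult)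
      also have "\<dots> \<le> 2 * E t" using E_ge[of i t] E_ge[of m t] im by simp
      finally have "\<bar>u i t * u m t\<bar> \<le> E t" by simp
      then show "\<bar>2 * (M i m * (u i t * u m t))\<bar> \<le> 2 * \<bar>M i m\<bar> * E t"
        by (simp add: abs_mult mult_left_mono)
    qed
    also have "\<dots> = K * E t" by (simp add: K_def sum_distrib_right)
    finally show ?thesis .
  qed
  have "E t = 0"
    using c by (intro gronwall_zero[OF dE _ bound _ _ t]) (auto simp: E_def sum_nonneg)
  then show ?thesis using E_ge[OF i, of t] by simp
qed

text \<open>A kernel vector \<open>y\<close> of \<open>A c\<close> yields the solution
  \<open>A t y\<close>, which vanishes at \<open>c\<close> and hence on the interval, so
  \<open>y\<close> stays in the kernel. Read backwards, invertibility inside an interval passes to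
  its end points.\<close>

lemma fundamental_matrix_det_zero:
  fixes A :: "real \<Rightarrow> real mat"
  assumes A: "\<And>t. A t \<in> carrier_mat N N"
    and der: "\<And>i j t. i < N \<Longrightarrow> j < N \<Longrightarrow>
      ((\<lambda>s. A s $$ (i, j)) has_real_derivative A' i j t) (at t)"
    and ode: "\<And>i j t. i < N \<Longrightarrow> j < N \<Longrightarrow> t \<in> {a<..<b} \<Longrightarrow>
      A' i j t = (\<Sum>m<N. M i m * A t $$ (m, j))"
    and c: "c = a \<or> c = b" "det (A c) = 0" and t: "t \<in> {a<..<b}"
  shows "det (A t) = 0"
proof -
  obtain y where y: "y \<in> carrier_vec N" "y \<noteq> 0\<^sub>v N" "A c *\<^sub>v y = 0\<^sub>v N"
    using c(2) det_0_iff_vec_prod_zero[OF A] by blast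
  define u where "u = (\<lambda>i t. \<Sum>j<N. A t $$ (i, j) * y $ j)"
  have Ay: "(A t *\<^sub>v y) $ i = u i t" if "i < N" for i t
    using that y(1) A[of t] by (auto simp: u_def scalar_prod_def lessThan_atLeast0)
  have "u i t = 0" if "i < N" for i
  proof (rule linear_system_zero[OF _ _ c(1) _ t that])
    fix i t assume i: "i < N"
    show "(u i has_real_derivative (\<Sum>j<N. A' i j t * y $ j)) (at t)"
      unfolding u_def using i by (auto intro!: derivative_eq_intros der sum.cong)
    show "(\<Sum>j<N. A' i j t * y $ j) = (\<Sum>m<N. M i m * u m t)" if "t \<in> {a<..<b}"
    proof -
      have "(\<Sum>j<N. A' i j t * y $ j) = (\<Sum>j<N. \<Sum>m<N. M i m * (A t $$ (m, j) * y $ j))"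
        using ode[OF i _ that] by (simp add: sum_distrib_right mult.assoc)
      also have "\<dots> = (\<Sum>m<N. M i m * u m t)"
        unfolding u_def by (subst sum.swap) (simp add: sum_distrib_left)
      finally show ?thesis .
    qed
  next
    fix i assume "i < N"
    then show "u i c = 0" using Ay[of i c] y(3) by simp
  qed
  then have "A t *\<^sub>v y = 0\<^sub>v N" using Ay A[of t]
    by (intro eq_vecI) (auto simp del: index_mult_mat_vec)
  then show ?thesis using y det_0_iff_vec_prod_zero[OF A] by blast
qed

text \<open>If \<open>s\<close> is missing, compactness gives a missing point between
  \<open>t0\<close> and \<open>s\<close> that is nearest to \<open>t0\<close>. The open interval
  from \<open>t0\<close> to that point lies in \<open>U\<close>, so \<open>ends\<close> puts the
  point into \<open>U\<close> after all.\<close>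

lemma open_real_eq_UNIV:
  fixes U :: "real set"
  assumes U: "open U" and t0: "t0 \<in> U"
    and ends: "\<And>a b. a < b \<Longrightarrow> {a<..<b} \<subseteq> U \<Longrightarrow> a \<in> U \<and> b \<in> U"
  shows "U = UNIV"
proof (rule ccontr)
  assume "U \<noteq> UNIV"
  then obtain s where s: "s \<notin> U" by blast
  show False
  proof (cases "t0 < s")
    case True
    have "s \<in> {t0..s} - U" using s True by simp
    then have "compact ({t0..s} - U)" "{t0..s} - U \<noteq> {}"
      using U by (blast intro: compact_diff compact_Icc)+
    then obtain b where b: "b \<in> {t0..s} - U" "\<And>x. x \<in> {t0..s} - U \<Longrightarrow> b \<le> x"
      using compact_attains_inf by metis
    have "t0 < b" using b(1) t0 by (cases "b = t0") auto
    moreover have "x \<in> U" if "x \<in> {t0<..<b}" for x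
      using b(1) b(2)[of x] that by (cases "x \<in> U") auto
    then have "{t0<..<b} \<subseteq> U" by blast
    ultimately show False using ends[of t0 b] b(1) by blast
  next
    case False
    have "s \<in> {s..t0} - U" using s False by simp
    then have "compact ({s..t0} - U)" "{s..t0} - U \<noteq> {}"
      using U by (blast intro: compact_diff compact_Icc)+
    then obtain b where b: "b \<in> {s..t0} - U" "\<And>x. x \<in> {s..t0} - U \<Longrightarrow> x \<le> b"
      using compact_attains_sup by metis
    have "b < t0" using b(1) t0 by (cases "b = t0") auto
    moreover have "x \<in> U" if "x \<in> {b<..<t0}" for x
      using b(1) b(2)[of x] that by (cases "x \<in> U") auto
    then have "{b<..<t0} \<subseteq> U" by blast
    ultimately show False using ends[of b t0] b(1) by blast
  qed
qed

section \<open>Coordinates\<close>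

abbreviation coord_deriv :: "(real \<Rightarrow> real vec) \<Rightarrow> nat \<Rightarrow> nat \<Rightarrow> real \<Rightarrow> real" where
  "coord_deriv w i m \<equiv> (deriv ^^ m) (\<lambda>s. w s $ i)"

text \<open>Entry \<open>l\<close> of the stacked column with blocks \<open>w^(j), w^(j+1), \<dots>\<close>.\<close>

definition stacked :: "nat \<Rightarrow> (real \<Rightarrow> real vec) \<Rightarrow> nat \<Rightarrow> nat \<Rightarrow> real \<Rightarrow> real" where
  "stacked k w l j = coord_deriv w (l mod k) (j + l div k)"

lemma C_space_DERIV:
  assumes "w \<in> C_space m k" "i < k" "l < m"
  shows "(coord_deriv w i l has_real_derivative coord_deriv w i (Suc l) t) (at t)"
proof -
  have "coord_deriv w i l differentiable (at t)"
    using assms by (auto simp: C_space_def)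
  then show ?thesis by (simp add: real_differentiable_def DERIV_deriv_iff_has_field_derivative
        DERIV_deriv_iff_real_differentiable)
qed

lemma C_space_continuous:
  assumes "w \<in> C_space m k" "i < k" "l \<le> m"
  shows "continuous_on UNIV (coord_deriv w i l)"
proof (cases "l = m")
  case True
  then show ?thesis using assms by (auto simp: C_space_def)
next
  case False
  then have "l < m" using assms by simp
  then show ?thesis using C_space_DERIV[OF assms(1,2)]
    by (meson DERIV_isCont continuous_at_imp_continuous_on)
qed

lemma C_space_mono:
  assumes "w \<in> C_space m k" "m' \<le> m"
  shows "w \<in> C_space m' k"
  using C_space_continuous[OF assms(1) _ assms(2)] assms
  by (auto simp: C_space_def)

lemma stacked_DERIV:
  assumes "w \<in> C_space m k" "k \<ge> 1" "j + l div k < m"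
  shows "(stacked k w l j has_real_derivative stacked k w l (Suc j) t) (at t)"
  unfolding stacked_def using C_space_DERIV[OF assms(1) _ assms(3)] assms(2) by simp

lemma nat_div_less: "l < n * k \<Longrightarrow> l div k < (n::nat)"
  by (simp add: less_mult_imp_div_less)

lemma sum_div_mod:
  assumes "k \<ge> (1::nat)"
  shows "(\<Sum>l<n * k. g (l div k) (l mod k)) = (\<Sum>a<n. \<Sum>b<k. g a b :: real)"
proof (induction n)
  case (Suc n)
  have "(\<Sum>l<Suc n * k. g (l div k) (l mod k)) =
      (\<Sum>l<n * k. g (l div k) (l mod k)) + (\<Sum>l = n * k..<n * k + k. g (l div k) (l mod k))"
    by (subst sum.union_disjoint[symmetric]) (auto intro!: sum.cong)
  also have "(\<Sum>l = n * k..<n * k + k. g (l div k) (l mod k)) = (\<Sum>b<k. g n b)"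
    using sum.shift_bounds_nat_ivl[of "\<lambda>l. g (l div k) (l mod k)" 0 "n * k" k]
    by (simp add: lessThan_atLeast0 add.commute)
  finally show ?case using Suc by simp
qed simp

section \<open>Entries of the Wronskian blocks and of the differential operator\<close>

lemma W_hat_carrier: "W_hat n k w t \<in> carrier_mat (n * k) (n * k)"
  and W_tilde_carrier: "W_tilde n k w t \<in> carrier_mat (n * k) k"
  and W_last_left_carrier: "W_last_left n k w t \<in> carrier_mat k (n * k)"
  and W_last_right_carrier: "W_last_right n k w t \<in> carrier_mat k k"
  by (simp_all add: W_hat_def W_tilde_def W_last_left_def W_last_right_def wronski_block_def)

lemma wronski_index:
  assumes "k \<ge> 1"
  shows "l < n * k \<Longrightarrow> j < n * k \<Longrightarrow> W_hat n k w t $$ (l, j) = stacked k w l j t"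
    and "l < n * k \<Longrightarrow> j < k \<Longrightarrow> W_tilde n k w t $$ (l, j) = stacked k w l (n * k + j) t"
    and "i < k \<Longrightarrow> j < n * k \<Longrightarrow> W_last_left n k w t $$ (i, j) = coord_deriv w i (n + j) t"
    and "i < k \<Longrightarrow> j < k \<Longrightarrow>
      W_last_right n k w t $$ (i, j) = coord_deriv w i (n + (n * k + j)) t"
  using assms
  by (simp_all add: W_hat_def W_tilde_def W_last_left_def W_last_right_def wronski_block_def
      nth_deriv_def stacked_def add_ac)

lemma poly_diff_op_index:
  assumes k: "k \<ge> 1" and R: "\<And>j. j \<in> {0..n} \<Longrightarrow> R j \<in> carrier_mat k k" and R0: "R 0 = 1\<^sub>m k"
    and i: "i < k"
  shows "poly_diff_op n k R w t $ i =
    coord_deriv w i n t + (\<Sum>l<n * k. R (n - l div k) $$ (i, l mod k) * stacked k w l 0 t)"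
proof -
  have nd: "nth_deriv k m w t \<in> carrier_vec k" for m by (simp add: nth_deriv_def)
  have "poly_diff_op n k R w t $ i = (\<Sum>j\<in>{0..n}. (R j *\<^sub>v nth_deriv k (n - j) w t) $ i)"
    unfolding poly_diff_op_def using mult_mat_vec_carrier[OF R nd]
    by (intro index_finsum_vec i) auto
  also have "\<dots> = (R 0 *\<^sub>v nth_deriv k n w t) $ i +
      (\<Sum>j\<in>{Suc 0..n}. (R j *\<^sub>v nth_deriv k (n - j) w t) $ i)"
    by (subst sum.atLeast_Suc_atMost) simp_all
  also have "(R 0 *\<^sub>v nth_deriv k n w t) $ i = coord_deriv w i n t"
    using R0 nd i by (simp add: nth_deriv_def)
  \<comment> \<open>Reindexing by the order \<open>a = n - j\<close> of the derivative matches the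
    block order of \<open>stacked\<close>.\<close>
  also have "(\<Sum>j\<in>{Suc 0..n}. (R j *\<^sub>v nth_deriv k (n - j) w t) $ i) =
      (\<Sum>a<n. (R (n - a) *\<^sub>v nth_deriv k a w t) $ i)"
    by (rule sum.reindex_bij_witness[of _ "\<lambda>a. n - a" "\<lambda>j. n - j"]) auto
  also have "\<dots> = (\<Sum>a<n. \<Sum>b<k. R (n - a) $$ (i, b) * coord_deriv w b a t)"
  proof (rule sum.cong[OF refl])
    fix a assume "a \<in> {..<n}"
    have "R (n - a) \<in> carrier_mat k k" by (rule R) simp
    then show "(R (n - a) *\<^sub>v nth_deriv k a w t) $ i =
        (\<Sum>b<k. R (n - a) $$ (i, b) * coord_deriv w b a t)"
      using i by (auto simp: scalar_prod_def nth_deriv_def lessThan_atLeast0)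
  qed
  also have "\<dots> = (\<Sum>l<n * k. R (n - l div k) $$ (i, l mod k) * stacked k w l 0 t)"
    unfolding stacked_def using sum_div_mod[OF k, of "\<lambda>a b. R (n - a) $$ (i, b) * coord_deriv w b a t" n]
    by simp
  finally show ?thesis .
qed

text \<open>Flattens the coefficient matrices into a single \<open>k\<close> by \<open>n * k\<close>
  array \<open>c\<close>, the constant matrix \<open>Q\<close> of the overview.\<close>

lemma LTID_iff:
  assumes k: "k \<ge> 1"
  shows "w \<in> LTID n k \<longleftrightarrow> w \<in> C_space n k \<and>
    (\<exists>c. \<forall>i<k. \<forall>t. coord_deriv w i n t = (\<Sum>l<n * k. c i l * stacked k w l 0 t))"
    (is "_ \<longleftrightarrow> _ \<and> ?P")
proof (intro iffI conjI)
  assume w: "w \<in> LTID n k"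
  then show "w \<in> C_space n k" by (simp add: LTID_def)
  obtain R where R: "\<And>j. j \<in> {0..n} \<Longrightarrow> R j \<in> carrier_mat k k" "R 0 = 1\<^sub>m k"
      "\<And>t. poly_diff_op n k R w t = 0\<^sub>v k"
    using w unfolding LTID_def by blast
  have "coord_deriv w i n t = (\<Sum>l<n * k. - R (n - l div k) $$ (i, l mod k) * stacked k w l 0 t)"
    if "i < k" for i t
    using poly_diff_op_index[where R = R and n = n, OF k R(1,2) that, of w t] R(3)[of t] that
    by (simp add: sum_negf)
  then show ?P by (intro exI[of _ "\<lambda>i l. - R (n - l div k) $$ (i, l mod k)"]) blast
next
  assume "w \<in> C_space n k \<and> ?P"
  then obtain c where w: "w \<in> C_space n k"
    and c: "\<And>i t. i < k \<Longrightarrow> coord_deriv w i n t = (\<Sum>l<n * k. c i l * stacked k w l 0 t)" by blast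
  \<comment> \<open>\<open>R j\<close> multiplies the derivative of order \<open>n - j\<close>, so
    its column \<open>b\<close> is column \<open>(n - j) * k + b\<close> of \<open>c\<close>; the
    sign comes from moving the sum to the other side.\<close>
  define R where
    "R = (\<lambda>j. if j = 0 then 1\<^sub>m k else mat k k (\<lambda>(i, b). - c i ((n - j) * k + b)))"
  have R: "R j \<in> carrier_mat k k" "R 0 = 1\<^sub>m k" for j by (auto simp: R_def)
  have "poly_diff_op n k R w t = 0\<^sub>v k" for t
  proof (rule eq_vecI)
    show "dim_vec (poly_diff_op n k R w t) = dim_vec (0\<^sub>v k)"
      unfolding poly_diff_op_def using mult_mat_vec_carrier[OF R(1)]
      by (simp add: finsum_vec_closed[THEN carrier_vecD] nth_deriv_def)
    fix i assume "i < dim_vec (0\<^sub>v k :: real vec)"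
    then have i: "i < k" by simp
    have "R (n - l div k) $$ (i, l mod k) = - c i l" if "l < n * k" for l
    proof -
      have "l div k < n" using that by (rule nat_div_less)
      then show ?thesis using i k by (simp add: R_def)
    qed
    then show "poly_diff_op n k R w t $ i = 0\<^sub>v k $ i"
      using poly_diff_op_index[where R = R and n = n, OF k R(1,2) i, of w t] c[OF i, of t] i by (simp add: sum_negf)
  qed
  then show "w \<in> LTID n k" using w R by (auto simp: LTID_def intro!: exI[of _ R])
qed

section \<open>Solutions satisfy the equation\<close>

text \<open>Bootstrapping: the right side at stage \<open>p\<close> involves only orders up to
  \<open>n + p - 1\<close>, so it can be differentiated once more, and \<open>w\<close> gains one
  order. Smoothness and recurrence feed each other, hence the joint induction.\<close>

lemma recurrence_smooth:
  assumes k: "k \<ge> 1" and w: "w \<in> C_space n k"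
    and c: "\<And>i t. i < k \<Longrightarrow> coord_deriv w i n t = (\<Sum>l<n * k. c i l * stacked k w l 0 t)"
  shows "w \<in> C_space (n + p) k \<and>
    (\<forall>i<k. \<forall>t. coord_deriv w i (n + p) t = (\<Sum>l<n * k. c i l * stacked k w l p t))"
proof (induction p)
  case 0
  then show ?case using w c by simp
next
  case (Suc p)
  then have wp: "w \<in> C_space (n + p) k"
    and cp: "\<And>i. i < k \<Longrightarrow> coord_deriv w i (n + p) = (\<lambda>t. \<Sum>l<n * k. c i l * stacked k w l p t)"
    by auto
  have der: "(coord_deriv w i (n + p) has_real_derivative
      (\<Sum>l<n * k. c i l * stacked k w l (Suc p) t)) (at t)" if "i < k" for i t
    unfolding cp[OF that]
    using stacked_DERIV[OF wp k] nat_div_less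
    by (auto intro!: DERIV_sum DERIV_cmult)
  have eq: "coord_deriv w i (n + Suc p) = (\<lambda>t. \<Sum>l<n * k. c i l * stacked k w l (Suc p) t)"
    if "i < k" for i
    using DERIV_imp_deriv[OF der[OF that]] by (intro ext) simp
  have "continuous_on UNIV (coord_deriv w i (n + Suc p))" if "i < k" for i
    unfolding eq[OF that] stacked_def
    using k nat_div_less
    by (intro continuous_on_sum continuous_on_mult continuous_on_const C_space_continuous[OF wp])
       (fastforce simp: Suc_le_eq)+
  moreover have "coord_deriv w i l differentiable (at t)" if "i < k" "l < n + Suc p" for i l t
  proof (cases "l = n + p")
    case True
    then show ?thesis using der[OF \<open>i < k\<close>] real_differentiable_def by blast
  next
    case False
    then show ?thesis using that wp by (auto simp: C_space_def)
  qed
  ultimately have "w \<in> C_space (n + Suc p) k" using wp by (auto simp: C_space_def)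
  then show ?case using eq by simp
qed

text \<open>The same matrix \<open>R\<close> gives \<open>C = R A\<close> and
  \<open>D = R B\<close>, so \<open>C\<close> times the inverse of \<open>A\<close> is
  \<open>R\<close>, and \<open>D - R B\<close> vanishes.\<close>

lemma recurrence_Op_zero:
  assumes k: "k \<ge> 1" and inv: "t \<in> Op_dom n k w"
    and c: "\<And>i p. i < k \<Longrightarrow> coord_deriv w i (n + p) t = (\<Sum>l<n * k. c i l * stacked k w l p t)"
  shows "Op n k w t = 0\<^sub>m k k"
proof -
  let ?A = "W_hat n k w t" and ?B = "W_tilde n k w t"
  let ?C = "W_last_left n k w t" and ?D = "W_last_right n k w t"
  define R where "R = mat k (n * k) (\<lambda>(i, l). c i l)"
  have R: "R \<in> carrier_mat k (n * k)" by (simp add: R_def)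
  note cs = W_hat_carrier[of n k w t] W_tilde_carrier[of n k w t]
  have d: "det ?A \<noteq> 0" using inv invertible_mat_iff_det[OF cs(1)] by (simp add: Op_dom_def)
  note I = the_mat_inverse[OF cs(1) d]
  have C: "?C = R * ?A"
    using c W_last_left_carrier[of n k w t] cs R wronski_index[OF k]
    by (intro eq_matI) (auto simp: scalar_prod_def R_def lessThan_atLeast0)
  have D: "?D = R * ?B"
    using c W_last_right_carrier[of n k w t] cs R wronski_index[OF k]
    by (intro eq_matI) (auto simp: scalar_prod_def R_def lessThan_atLeast0)
  have "?C * the (mat_inverse ?A) = R"
    unfolding C using R cs I by simp
  then show ?thesis
    unfolding Op_def schur_complement_def D using R cs by simp
qed

section \<open>Solutions of the equation satisfy a linear system\<close>

text \<open>\<open>Q = W_last_left W_hat^(-1)\<close>, with the inverse written through the adjugate so that its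
  entries are visibly differentiable; where \<open>W_hat\<close> is singular, division by \<open>0\<close> makes it \<open>0\<close>.\<close>

definition coeff_mat :: "nat \<Rightarrow> nat \<Rightarrow> (real \<Rightarrow> real vec) \<Rightarrow> nat \<Rightarrow> nat \<Rightarrow> real \<Rightarrow> real" where
  "coeff_mat n k w i l t = (\<Sum>m<n * k.
     coord_deriv w i (n + m) t * (1 / det (W_hat n k w t) * cofactor (W_hat n k w t) l m))"

text \<open>For \<open>j < n * k\<close> this is \<open>Q W_hat = W_last_left\<close>, true by the
  choice of \<open>Q\<close>; the remaining \<open>k\<close> columns are exactly the vanishing of
  the Schur complement.\<close>

lemma coeff_mat_recurrence:
  assumes k: "k \<ge> 1" and inv: "t \<in> Op_dom n k w" and Op: "Op n k w t = 0\<^sub>m k k"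
    and i: "i < k" and j: "j < n * k + k"
  shows "coord_deriv w i (n + j) t = (\<Sum>l<n * k. coeff_mat n k w i l t * stacked k w l j t)"
proof -
  let ?A = "W_hat n k w t" and ?B = "W_tilde n k w t"
  let ?C = "W_last_left n k w t" and ?D = "W_last_right n k w t"
  note cs = W_hat_carrier[of n k w t] W_tilde_carrier[of n k w t]
    W_last_left_carrier[of n k w t] W_last_right_carrier[of n k w t]
  have d: "det ?A \<noteq> 0" using inv invertible_mat_iff_det[OF cs(1)] by (simp add: Op_dom_def)
  note I = the_mat_inverse[OF cs(1) d]
  define Q where "Q = ?C * the (mat_inverse ?A)"
  have Q: "Q \<in> carrier_mat k (n * k)" using cs I by (simp add: Q_def)
  have Qi: "Q $$ (i, l) = coeff_mat n k w i l t" if "l < n * k" for l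
    unfolding Q_def I(4) coeff_mat_def using that i cs adj_mat(1)[OF cs(1)] wronski_index(3)[OF k i]
    by (auto simp: scalar_prod_def lessThan_atLeast0 adj_mat_def)
  have QA: "Q * ?A = ?C" unfolding Q_def using cs I by (simp add: assoc_mult_mat[of _ k "n*k" _ "n*k" _ "n*k"])
  have sub: "?D - Q * ?B = 0\<^sub>m k k" using Op by (simp add: Op_def schur_complement_def Q_def)
  have QB: "(Q * ?B) $$ (i, b) = ?D $$ (i, b)" if "b < k" for b
    using arg_cong[OF sub, of "\<lambda>X. X $$ (i, b)"] i that Q cs by simp
  show ?thesis
  proof (cases "j < n * k")
    case True
    have "coord_deriv w i (n + j) t = (Q * ?A) $$ (i, j)"
      unfolding QA using wronski_index(3)[OF k i True] by simp
    also have "\<dots> = (\<Sum>l<n * k. Q $$ (i, l) * ?A $$ (l, j))"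
      using Q cs i True by (auto simp: scalar_prod_def lessThan_atLeast0)
    finally show ?thesis using Qi wronski_index(1)[OF k _ True] by simp
  next
    case False
    define b where "b = j - n * k"
    have b: "b < k" "j = n * k + b" using False j by (auto simp: b_def)
    have "coord_deriv w i (n + j) t = (Q * ?B) $$ (i, b)"
      unfolding QB[OF b(1)] using wronski_index(4)[OF k i b(1)] b(2) by simp
    also have "\<dots> = (\<Sum>l<n * k. Q $$ (i, l) * ?B $$ (l, b))"
      using Q cs i b by (auto simp: scalar_prod_def lessThan_atLeast0)
    finally show ?thesis using Qi wronski_index(2)[OF k _ b(1)] b(2) by simp
  qed
qed

text \<open>The order \<open>n + n * k + k - 1\<close> is the highest derivative occurring in
  \<open>Op\<close>, in the last column of \<open>W_last_right\<close>.\<close>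

context
  fixes n k :: nat and w :: "real \<Rightarrow> real vec"
  assumes k: "k \<ge> 1" and w: "w \<in> C_space (n + n * k + k - 1) k"
begin

section \<open>Openness of the domain of \<open>Op\<close> and differentiability of
  \<open>Q\<close>\<close>

lemma coord_DERIV:
  "i < k \<Longrightarrow> m < n + n * k + k - 1 \<Longrightarrow>
    (coord_deriv w i m has_real_derivative coord_deriv w i (Suc m) t) (at t)"
  using C_space_DERIV[OF w] .

lemma stacked_W_DERIV:
  assumes "l < n * k" "j < n * k"
  shows "(stacked k w l j has_real_derivative stacked k w l (Suc j) t) (at t)"
  using nat_div_less[OF assms(1)] assms(2) k by (intro stacked_DERIV[OF w k]) simp

lemma W_hat_DERIV:
  assumes "l < n * k" "j < n * k"
  shows "((\<lambda>t. W_hat n k w t $$ (l, j)) has_real_derivative stacked k w l (Suc j) t) (at t)"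
  using stacked_W_DERIV[OF assms] wronski_index(1)[OF k assms] by simp

lemma det_W_hat_differentiable: "(\<lambda>s. det (W_hat n k w s)) differentiable (at t)"
  using W_hat_DERIV real_differentiable_def
  by (intro det_differentiable[OF W_hat_carrier]) blast

lemma Op_dom_iff: "t \<in> Op_dom n k w \<longleftrightarrow> det (W_hat n k w t) \<noteq> 0"
  using invertible_mat_iff_det[OF W_hat_carrier] by (simp add: Op_dom_def)

lemma open_Op_dom: "open (Op_dom n k w)"
proof -
  have "continuous_on UNIV (\<lambda>s. det (W_hat n k w s))"
    using det_W_hat_differentiable differentiable_imp_continuous_within
    by (blast intro: continuous_at_imp_continuous_on)
  then have "open {t. det (W_hat n k w t) \<noteq> 0}"
    by (intro open_Collect_neq continuous_on_const)
  then show ?thesis by (simp add: Op_dom_iff[symmetric])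
qed

lemma coeff_mat_differentiable:
  assumes t: "t \<in> Op_dom n k w" and i: "i < k"
  shows "coeff_mat n k w i l differentiable (at t)"
proof -
  have "coord_deriv w i (n + m) differentiable (at t)" if "m < n * k" for m
    using coord_DERIV[OF i, of "n + m" t] that k unfolding real_differentiable_def by force
  moreover have "(\<lambda>s. cofactor (W_hat n k w s) l m) differentiable (at t)" for m
    using W_hat_DERIV real_differentiable_def
    by (intro cofactor_differentiable[OF W_hat_carrier]) blast
  ultimately show ?thesis
    unfolding coeff_mat_def[abs_def] using t
    by (intro differentiable_sum ballI differentiable_mult differentiable_divide
        differentiable_const det_W_hat_differentiable) (auto simp: Op_dom_iff)
qed

context
  assumes Op: "\<And>t. t \<in> Op_dom n k w \<Longrightarrow> Op n k w t = 0\<^sub>m k k"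
begin

text \<open>Differentiate \<open>Q v = y\<close>, where \<open>v\<close> is column \<open>j\<close> of \<open>W_hat\<close>, and subtract the same
  relation for column \<open>j + 1\<close>: what remains is \<open>Q' v = 0\<close> for every column of an invertible
  matrix.\<close>

lemma coeff_mat_DERIV_zero:
  assumes t: "t \<in> Op_dom n k w" and i: "i < k" and l: "l < n * k"
  shows "(coeff_mat n k w i l has_real_derivative 0) (at t)"
proof -
  define q' where "q' = (\<lambda>l. deriv (coeff_mat n k w i l) t)"
  have q': "(coeff_mat n k w i l has_real_derivative q' l) (at t)" for l
    using coeff_mat_differentiable[OF t i] DERIV_deriv_iff_real_differentiable
    by (auto simp: q'_def)
  have "(\<Sum>l<n * k. q' l * W_hat n k w t $$ (l, j)) = 0" if j: "j < n * k" for j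
  proof -
    let ?S = "\<lambda>s. \<Sum>l<n * k. coeff_mat n k w i l s * stacked k w l j s"
    have "(?S has_real_derivative
        (\<Sum>l<n * k. q' l * stacked k w l j t + coeff_mat n k w i l t * stacked k w l (Suc j) t)) (at t)"
      using stacked_W_DERIV j q'
      by (intro DERIV_sum) (auto intro!: derivative_eq_intros)
    moreover have "(?S has_real_derivative coord_deriv w i (Suc (n + j)) t) (at t)"
    \<comment> \<open>The relation is known only on \<open>Op_dom\<close>; since this set is open,
      it may still be differentiated at \<open>t\<close>.\<close>
    proof (rule has_field_derivative_transform_within_open[OF _ open_Op_dom t])
      show "(coord_deriv w i (n + j) has_real_derivative coord_deriv w i (Suc (n + j)) t) (at t)"
        using j k by (intro coord_DERIV[OF i]) simp
    next
      fix s assume "s \<in> Op_dom n k w"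
      then show "coord_deriv w i (n + j) s = ?S s"
        using coeff_mat_recurrence[OF k _ Op i, of s j] j by simp
    qed
    ultimately have "(\<Sum>l<n * k. q' l * stacked k w l j t +
        coeff_mat n k w i l t * stacked k w l (Suc j) t) = coord_deriv w i (n + Suc j) t"
      by (simp add: DERIV_unique)
    \<comment> \<open>For \<open>j = n * k - 1\<close> this uses column \<open>n * k\<close>, the
      first one beyond \<open>W_hat\<close>, where \<open>Op\<close> being zero is
      essential.\<close>
    also have "\<dots> = (\<Sum>l<n * k. coeff_mat n k w i l t * stacked k w l (Suc j) t)"
      using j k by (intro coeff_mat_recurrence[OF k t Op[OF t] i]) simp
    finally show ?thesis using wronski_index(1)[OF k _ j] by (simp add: sum.distrib)
  qed
  then have "q' l = 0"
    using left_kernel_trivial[OF W_hat_carrier _ _ l] t by (simp add: Op_dom_iff)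
  then show ?thesis using q'[of l] by simp
qed

text \<open>On the interval \<open>Q\<close> is constant, so the columns of \<open>W_hat\<close>
  solve one constant coefficient system there. A singular \<open>W_hat\<close> at an end point would
  then be singular at the midpoint too.\<close>

lemma Op_dom_ends:
  assumes ab: "a < b" "{a<..<b} \<subseteq> Op_dom n k w" and c: "c = a \<or> c = b"
  shows "c \<in> Op_dom n k w"
proof (rule ccontr)
  assume "c \<notin> Op_dom n k w"
  then have det0: "det (W_hat n k w c) = 0" by (simp add: Op_dom_iff)
  define t0 where "t0 = (a + b) / 2"
  have t0: "t0 \<in> {a<..<b}" using ab(1) by (simp add: t0_def)
  \<comment> \<open>The block companion matrix: all block rows but the last shift down by
    \<open>k\<close> entries, and the last one is \<open>Q\<close> frozen at
    \<open>t0\<close>.\<close>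
  define M where "M = (\<lambda>l m. if l + k < n * k then (if m = l + k then 1 else 0)
      else coeff_mat n k w (l mod k) m t0)"
  have const: "coeff_mat n k w i l t = coeff_mat n k w i l t0"
    if "i < k" "l < n * k" "t \<in> {a<..<b}" for i l t
    using DERIV_isconst3[OF ab(1) that(3) t0] coeff_mat_DERIV_zero that ab(2) by blast
  have ode: "stacked k w l (Suc j) t = (\<Sum>m<n * k. M l m * W_hat n k w t $$ (m, j))"
    if l: "l < n * k" and j: "j < n * k" and t: "t \<in> {a<..<b}" for l j t
  proof (cases "l + k < n * k")
    case True
    have "(\<Sum>m<n * k. M l m * W_hat n k w t $$ (m, j)) =
        (\<Sum>m<n * k. if m = l + k then W_hat n k w t $$ (m, j) else 0)"
      using True by (intro sum.cong) (auto simp: M_def)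
    also have "\<dots> = stacked k w (l + k) j t"
      using True wronski_index(1)[OF k True j] by simp
    also have "\<dots> = stacked k w l (Suc j) t"
      using k by (simp add: stacked_def div_add_self2)
    finally show ?thesis by simp
  next
    case False
    have "l div k < n" using l by (rule nat_div_less)
    \<comment> \<open>Row \<open>l\<close> lies in the last block, so differentiating its entry
      reaches order \<open>n + j\<close>, which the recurrence expresses through column
      \<open>j\<close>.\<close>
    moreover have "n - 1 \<le> l div k"
    proof -
      have "(n - 1) * k \<le> l" using False by (simp add: diff_mult_distrib)
      then show ?thesis using k div_le_mono[of "(n - 1) * k" l k] by simp
    qed
    ultimately have ld: "Suc j + l div k = n + j" by simp
    have i: "l mod k < k" using k by simp
    have "stacked k w l (Suc j) t = coord_deriv w (l mod k) (n + j) t"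
      unfolding stacked_def ld ..
    also have "\<dots> = (\<Sum>m<n * k. coeff_mat n k w (l mod k) m t * stacked k w m j t)"
      using j t ab(2) by (intro coeff_mat_recurrence[OF k _ Op i]) auto
    also have "\<dots> = (\<Sum>m<n * k. M l m * W_hat n k w t $$ (m, j))"
      using False const[OF i _ t] wronski_index(1)[OF k _ j] by (simp add: M_def)
    finally show ?thesis .
  qed
  have "det (W_hat n k w t0) = 0"
    by (rule fundamental_matrix_det_zero[OF W_hat_carrier W_hat_DERIV ode c det0 t0])
  then show False using t0 ab(2) Op_dom_iff by blast
qed

text \<open>The domain is open and keeps the end points of its intervals, so it is the whole line
  and \<open>Q\<close> is constant there. The recurrence for column 0 is then the differential
  equation sought.\<close>

lemma Op_zero_imp_LTID:
  assumes "Op_dom n k w \<noteq> {}"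
  shows "w \<in> LTID n k"
proof -
  have U: "Op_dom n k w = UNIV"
    using assms open_real_eq_UNIV[OF open_Op_dom] Op_dom_ends by blast
  have const: "coeff_mat n k w i l t = coeff_mat n k w i l 0" if "i < k" "l < n * k" for i l t
    using DERIV_isconst_all coeff_mat_DERIV_zero[OF _ that] U by blast
  have "coord_deriv w i n t = (\<Sum>l<n * k. coeff_mat n k w i l 0 * stacked k w l 0 t)"
    if i: "i < k" for i t
    using coeff_mat_recurrence[OF k _ Op i, of t 0] const[OF i, of _ t] U k by simp
  moreover have "w \<in> C_space n k" using k by (intro C_space_mono[OF w]) simp
  ultimately show ?thesis
    unfolding LTID_iff[OF k] by (intro conjI exI[of _ "\<lambda>i l. coeff_mat n k w i l 0"]) auto
qed

end

end

text \<open>For a \<open>w\<close> with empty \<open>Op_dom\<close> the condition on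
  \<open>Op\<close> is vacuous, so the equality of sets compares functions for which
  \<open>Op\<close> is defined somewhere.\<close>

theorem mainTheorem3:
  fixes n k :: nat
  assumes "n \<ge> 1" and "k \<ge> 1"
  shows "(\<forall>w \<in> LTID n k. w \<in> C_space (n + n * k + k - 1) k \<and>
            (\<forall>t \<in> Op_dom n k w. Op n k w t = 0\<^sub>m k k)) \<and>
         {w \<in> C_space (n + n * k + k - 1) k.
            Op_dom n k w \<noteq> {} \<and> (\<forall>t \<in> Op_dom n k w. Op n k w t = 0\<^sub>m k k)}
          = {w \<in> LTID n k. Op_dom n k w \<noteq> {}}"
proof -
  have necessary: "w \<in> C_space (n + n * k + k - 1) k \<and> (\<forall>t \<in> Op_dom n k w. Op n k w t = 0\<^sub>m k k)"
    if w: "w \<in> LTID n k" for w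
  proof -
    obtain c where wn: "w \<in> C_space n k"
      and c: "\<And>i t. i < k \<Longrightarrow> coord_deriv w i n t = (\<Sum>l<n * k. c i l * stacked k w l 0 t)"
      using w unfolding LTID_iff[OF assms(2)] by blast
    note smooth = recurrence_smooth[OF assms(2) wn c]
    have "w \<in> C_space (n + n * k + k - 1) k"
      using C_space_mono[OF conjunct1[OF smooth[of "n * k + k"]]] by simp
    then show ?thesis using recurrence_Op_zero[OF assms(2)] smooth by blast
  qed
  moreover have "w \<in> LTID n k"
    if "w \<in> C_space (n + n * k + k - 1) k" "Op_dom n k w \<noteq> {}"
      "\<forall>t \<in> Op_dom n k w. Op n k w t = 0\<^sub>m k k" for w
    using Op_zero_imp_LTID[OF assms(2) that(1) _ that(2)] that(3) by blast
  ultimately show ?thesis by blast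
qed

end
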